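(* Let $I$ and $H$ be linear cycle sets and let $\diamond\colon H\times I\to I$, $\leftthreetimes\colon I\times H\to I$, $\beta\colon H\times H\to I$ and $f\colon H\times H\to I$ be maps such that, for all $h\in H$ and $y,y'\in I$: $h\diamond(y+y')=h\diamond y+h\diamond y'$, $0\diamond y=y$, $0\leftthreetimes h=0$ and $y\leftthreetimes 0=0$. Assume that $h\diamond(y\leftthreetimes h')$, $h\diamond\beta(h',h'')$ and $h\diamond f(h',h'')$ belong to the center $Z(I)$ of $I$ for all $h,h',h''\in H$ and $y\in I$. Endow $I\times H$ with the operations $$(y,h)+(y',h')=(y+y'+\beta(h,h'),\,h+h'),$$ $$(y,h)\cdot(y',h')=\bigl((h\diamond y)\cdot(h\diamond y')+(h\diamond y)\cdot f(h,h')+(h\diamond y)\leftthreetimes(h\cdot h'),\ h\cdot h'\bigr).$$ Then $I\times H$ with these operations is a linear cycle set and $0\to I\xrightarrow{\iota} I\times H\xrightarrow{\pi}H\to 0$, with $\iota(y)=(y,0)$ and $\pi(y,h)=h$, is an extension of linear cycle sets if and only if the maps $y\mapsto h\diamond y$ are permutations of $I$ for all $h\in H$ and, for all $h,h',h''\in H$ and $y,y'\in I$: \begin{align*} &\beta(h,h')+\beta(h+h',h'')=\beta(h',h'')+\beta(h,h'+h''),\\ &\beta(h,0)=\beta(0,h)=0\quad\text{and}\quad\beta(h,h')=\beta(h',h),\\ &h\diamond\beta(h',h'')+f(h,h'+h'')=f(h,h')+f(h,h'')+\beta(h\cdot h',h\cdot h''),\\ &y\leftthreetimes(h'+h'')=y\leftthreetimes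 h'+y\leftthreetimes h'',\\ &(h\diamond y)\cdot(h\diamond y')=h\diamond(y\cdot y')\quad\text{and}\quad(h+h')\diamond y=(h\cdot h')\diamond(h\diamond y),\\ &(y+y')\leftthreetimes h=(y\leftthreetimes h)+\bigl((y\cdot y')\leftthreetimes h\bigr),\\ &(h\diamond y)\leftthreetimes(h\cdot h')=h\diamond(y\leftthreetimes h')+\bigl(h\diamond(y\leftthreetimes h)\bigr)\leftthreetimes(h\cdot h'),\\ &f(h+h',h'')+\bigl((h+h')\diamond\beta(h,h')\bigr)\leftthreetimes\bigl((h+h')\cdot h''\bigr)\\ &\quad=(h\cdot h')\diamond f(h,h'')+f(h\cdot h',h\cdot h'')+\bigl((h\cdot h')\diamond f(h,h')\bigr)\leftthreetimes\bigl((h\cdot h')\cdot(h\cdot h'')\bigr). \end{align*}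
   Context: A linear cycle set is an abelian group $(A,+)$ with a binary operation $\cdot$ such that for each $b\in A$ the map $a\mapsto b\cdot a$ is bijective, and $a\cdot(b+c)=a\cdot b+a\cdot c$ and $(a+b)\cdot c=(a\cdot b)\cdot(a\cdot c)$ for all $a,b,c\in A$. Morphisms preserve $+$ and $\cdot$. The center $Z(I)$ of a linear cycle set $I$ is the set of all $y\in I$ such that $y\cdot a=a$ and $a\cdot y=y$ for all $a\in I$. An extension of a linear cycle set $H$ by a linear cycle set $I$ is a short exact sequence of abelian groups $0\to I\xrightarrow{\iota}B\xrightarrow{\pi}H\to0$ in which $B$ is a linear cycle set and $\iota,\pi$ are morphisms of linear cycle sets. *)

theory Defs
  imports "HOL-Algebra.Elementary_Groups"
begin

text \<open>
  The additive group is the underlying \<open>monoid\<close> record, so that the notions of HOL-Algebra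
  (\<open>comm_group\<close>, \<open>hom\<close>, \<open>mon\<close>, \<open>epi\<close>, \<open>kernel\<close>) apply directly; only its notation is additive.
\<close>

record 'a cycle_struct = "'a monoid" +
  dot :: "'a \<Rightarrow> 'a \<Rightarrow> 'a" (infixl \<open>\<cdot>\<index>\<close> 70)

abbreviation plus_of :: "('a, 'm) monoid_scheme \<Rightarrow> 'a \<Rightarrow> 'a \<Rightarrow> 'a"
  (infixl \<open>\<^bold>+\<index>\<close> 65)
  where "plus_of A x y \<equiv> monoid.mult A x y"

abbreviation zero_of :: "('a, 'm) monoid_scheme \<Rightarrow> 'a"
  (\<open>\<^bold>0\<index>\<close>)
  where "zero_of A \<equiv> monoid.one A"

locale linear_cycle_set = comm_group A for A :: "('a, 'm) cycle_struct_scheme" (structure) +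
  assumes dot_bij: "b \<in> carrier A \<Longrightarrow> bij_betw (\<lambda>a. b \<cdot> a) (carrier A) (carrier A)"
    and dot_add_right: "\<lbrakk>a \<in> carrier A; b \<in> carrier A; c \<in> carrier A\<rbrakk>
      \<Longrightarrow> a \<cdot> (b \<^bold>+ c) = a \<cdot> b \<^bold>+ a \<cdot> c"
    and dot_add_left: "\<lbrakk>a \<in> carrier A; b \<in> carrier A; c \<in> carrier A\<rbrakk>
      \<Longrightarrow> (a \<^bold>+ b) \<cdot> c = (a \<cdot> b) \<cdot> (a \<cdot> c)"

definition lcs_hom ::
  "('a, 'm) cycle_struct_scheme \<Rightarrow> ('b, 'n) cycle_struct_scheme \<Rightarrow> ('a \<Rightarrow> 'b) set"
  where "lcs_hom A B = {\<phi> \<in> hom A B.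
    \<forall>x\<in>carrier A. \<forall>y\<in>carrier A. \<phi> (x \<cdot>\<^bsub>A\<^esub> y) = \<phi> x \<cdot>\<^bsub>B\<^esub> \<phi> y}"

definition lcs_center :: "('a, 'm) cycle_struct_scheme \<Rightarrow> 'a set"
  where "lcs_center A = {y \<in> carrier A. \<forall>a\<in>carrier A. y \<cdot>\<^bsub>A\<^esub> a = a \<and> a \<cdot>\<^bsub>A\<^esub> y = y}"

text \<open>
  \<open>short_exact_sequence\<close> of HOL-Algebra requires its three groups to have the same element type,
  so exactness is spelled out here as in \<open>short_exact_sequence_iff\<close>.
\<close>

definition lcs_extension ::
  "('i, 'm) cycle_struct_scheme \<Rightarrow> ('b, 'k) cycle_struct_scheme \<Rightarrow> ('h, 'n) cycle_struct_scheme
    \<Rightarrow> ('i \<Rightarrow> 'b) \<Rightarrow> ('b \<Rightarrow> 'h) \<Rightarrow> bool"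
  where "lcs_extension I B H \<iota> \<pi> \<longleftrightarrow>
    linear_cycle_set I \<and> linear_cycle_set B \<and> linear_cycle_set H \<and>
    \<iota> \<in> lcs_hom I B \<and> \<pi> \<in> lcs_hom B H \<and>
    \<iota> \<in> mon I B \<and> \<pi> \<in> epi B H \<and> kernel B H \<pi> = \<iota> ` carrier I"

text \<open>
  The record needs a designated neutral element. The choice below is forced:
  \<open>y \<mapsto> (y, 0)\<close> can only be a group homomorphism if \<open>(0, 0)\<close> is neutral.
\<close>

definition ext_prod ::
  "('i, 'm) cycle_struct_scheme \<Rightarrow> ('h, 'n) cycle_struct_scheme \<Rightarrow> ('h \<Rightarrow> 'i \<Rightarrow> 'i) \<Rightarrow>
    ('i \<Rightarrow> 'h \<Rightarrow> 'i) \<Rightarrow> ('h \<Rightarrow> 'h \<Rightarrow> 'i) \<Rightarrow> ('h \<Rightarrow> 'h \<Rightarrow> 'i) \<Rightarrow> ('i \<times> 'h) cycle_struct"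
  where "ext_prod I H dia tri \<beta> f =
    \<lparr>carrier = carrier I \<times> carrier H,
     mult = (\<lambda>(y, h) (y', h'). (y \<^bold>+\<^bsub>I\<^esub> y' \<^bold>+\<^bsub>I\<^esub> \<beta> h h', h \<^bold>+\<^bsub>H\<^esub> h')),
     one = (\<^bold>0\<^bsub>I\<^esub>, \<^bold>0\<^bsub>H\<^esub>),
     dot = (\<lambda>(y, h) (y', h').
       (dia h y \<cdot>\<^bsub>I\<^esub> dia h y' \<^bold>+\<^bsub>I\<^esub> dia h y \<cdot>\<^bsub>I\<^esub> f h h' \<^bold>+\<^bsub>I\<^esub> tri (dia h y) (h \<cdot>\<^bsub>H\<^esub> h'),
        h \<cdot>\<^bsub>H\<^esub> h'))\<rparr>"

end

theory Submission
  imports Defs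
begin

text \<open>
  Since \<open>0\<close> acts trivially, all values of \<open>\<beta>\<close>, \<open>f\<close> and \<open>\<leftthreetimes>\<close> are central in \<open>I\<close>, so they act
  trivially and may be moved out of every product. The two distributive laws of \<open>I \<times> H\<close> thereby
  become single equations in \<open>I\<close>. Setting arguments to zero in these equations yields the
  conditions one at a time; conversely the conditions add up to them, because \<open>\<leftthreetimes>\<close> is additive in
  its first argument when one of the summands is central.
\<close>

section \<open>Multiplication by zero and the center of a linear cycle set\<close>

context linear_cycle_set
begin

lemma dot_closed [simp]: "b \<in> carrier A \<Longrightarrow> a \<in> carrier A \<Longrightarrow> b \<cdot> a \<in> carrier A"
  using dot_bij[of b] by (auto simp: bij_betw_def)

lemma dot_zero [simp]:
  assumes "a \<in> carrier A" shows "a \<cdot> \<^bold>0 = \<^bold>0"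
  using dot_add_right[of a "\<^bold>0" "\<^bold>0"] assms by simp

text \<open>Multiplication by \<open>0\<close> is idempotent, by left distributivity and
  \<open>0 \<cdot> 0 = 0\<close>, and it is injective, so it is the identity.\<close>

lemma zero_dot [simp]:
  assumes a: "a \<in> carrier A" shows "\<^bold>0 \<cdot> a = a"
proof -
  have "\<^bold>0 \<cdot> (\<^bold>0 \<cdot> a) = \<^bold>0 \<cdot> a"
    using dot_add_left[of "\<^bold>0" "\<^bold>0" a] a by simp
  then show ?thesis
    using dot_bij[of "\<^bold>0"] a by (auto simp: bij_betw_def inj_on_def)
qed

lemma center_carrier [simp]: "z \<in> lcs_center A \<Longrightarrow> z \<in> carrier A"
  unfolding lcs_center_def by blast

lemma dot_center [simp]: "z \<in> lcs_center A \<Longrightarrow> a \<in> carrier A \<Longrightarrow> a \<cdot> z = z"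
  unfolding lcs_center_def by blast

lemma center_dot [simp]: "z \<in> lcs_center A \<Longrightarrow> a \<in> carrier A \<Longrightarrow> z \<cdot> a = a"
  unfolding lcs_center_def by blast

lemma center_add [simp]:
  assumes "z \<in> lcs_center A" "w \<in> lcs_center A" shows "z \<^bold>+ w \<in> lcs_center A"
proof -
  have "(z \<^bold>+ w) \<cdot> a = a \<and> a \<cdot> (z \<^bold>+ w) = z \<^bold>+ w" if "a \<in> carrier A" for a
    using that assms by (simp add: dot_add_left dot_add_right)
  then show ?thesis
    using assms unfolding lcs_center_def[of A] by blast
qed

text \<open>With the central summand in front, left distributivity gives
  \<open>(z \<cdot> a) \<cdot> (z \<cdot> b)\<close>, where \<open>z\<close> acts trivially on both
  factors. This is how central values disappear from left factors.\<close>

lemma add_center_dot [simp]: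
  assumes "z \<in> lcs_center A" "a \<in> carrier A" "b \<in> carrier A"
  shows "(a \<^bold>+ z) \<cdot> b = a \<cdot> b"
  using assms dot_add_left[of z a b] by (simp add: m_comm)

end

section \<open>The operations on the product and their distributive laws\<close>

text \<open>The hypotheses on the four maps as pointwise rules. \<open>tri_center\<close>,
  \<open>\<beta>_center\<close> and \<open>f_center\<close> record the instances of the centrality
  hypotheses in which \<open>0\<close> acts.\<close>

locale extension_datum = I: linear_cycle_set I + H: linear_cycle_set H
  for I :: "('i, 'm) cycle_struct_scheme" and H :: "('h, 'n) cycle_struct_scheme" +
  fixes dia :: "'h \<Rightarrow> 'i \<Rightarrow> 'i" (infixr \<open>\<diamondop>\<close> 75)
    and tri :: "'i \<Rightarrow> 'h \<Rightarrow> 'i" (infixl \<open>\<leftthreetimes>\<close> 75)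
    and \<beta> f :: "'h \<Rightarrow> 'h \<Rightarrow> 'i"
  assumes dia_closed [simp]: "\<lbrakk>h \<in> carrier H; y \<in> carrier I\<rbrakk> \<Longrightarrow> h \<diamondop> y \<in> carrier I"
    and dia_add: "\<lbrakk>h \<in> carrier H; y \<in> carrier I; y' \<in> carrier I\<rbrakk>
      \<Longrightarrow> h \<diamondop> (y \<^bold>+\<^bsub>I\<^esub> y') = (h \<diamondop> y) \<^bold>+\<^bsub>I\<^esub> (h \<diamondop> y')"
    and zero_dia [simp]: "y \<in> carrier I \<Longrightarrow> \<^bold>0\<^bsub>H\<^esub> \<diamondop> y = y"
    and zero_tri [simp]: "h \<in> carrier H \<Longrightarrow> \<^bold>0\<^bsub>I\<^esub> \<leftthreetimes> h = \<^bold>0\<^bsub>I\<^esub>"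
    and tri_zero [simp]: "y \<in> carrier I \<Longrightarrow> y \<leftthreetimes> \<^bold>0\<^bsub>H\<^esub> = \<^bold>0\<^bsub>I\<^esub>"
    and tri_center [simp]: "\<lbrakk>y \<in> carrier I; h \<in> carrier H\<rbrakk> \<Longrightarrow> y \<leftthreetimes> h \<in> lcs_center I"
    and \<beta>_center [simp]: "\<lbrakk>h \<in> carrier H; h' \<in> carrier H\<rbrakk> \<Longrightarrow> \<beta> h h' \<in> lcs_center I"
    and f_center [simp]: "\<lbrakk>h \<in> carrier H; h' \<in> carrier H\<rbrakk> \<Longrightarrow> f h h' \<in> lcs_center I"
    and dia_tri_center [simp]: "\<lbrakk>h \<in> carrier H; y \<in> carrier I; h' \<in> carrier H\<rbrakk>
      \<Longrightarrow> h \<diamondop> (y \<leftthreetimes> h') \<in> lcs_center I"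
    and dia_\<beta>_center [simp]: "\<lbrakk>h \<in> carrier H; h' \<in> carrier H; h'' \<in> carrier H\<rbrakk>
      \<Longrightarrow> h \<diamondop> \<beta> h' h'' \<in> lcs_center I"
    and dia_f_center [simp]: "\<lbrakk>h \<in> carrier H; h' \<in> carrier H; h'' \<in> carrier H\<rbrakk>
      \<Longrightarrow> h \<diamondop> f h' h'' \<in> lcs_center I"
begin

abbreviation B where "B \<equiv> ext_prod I H (\<diamondop>) (\<leftthreetimes>) \<beta> f"

lemma tri_closed [simp]: "\<lbrakk>y \<in> carrier I; h \<in> carrier H\<rbrakk> \<Longrightarrow> y \<leftthreetimes> h \<in> carrier I"
  by (rule I.center_carrier) simp

lemma \<beta>_closed [simp]: "\<lbrakk>h \<in> carrier H; h' \<in> carrier H\<rbrakk> \<Longrightarrow> \<beta> h h' \<in> carrier I"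
  by (rule I.center_carrier) simp

lemma f_closed [simp]: "\<lbrakk>h \<in> carrier H; h' \<in> carrier H\<rbrakk> \<Longrightarrow> f h h' \<in> carrier I"
  by (rule I.center_carrier) simp

lemma dia_zero [simp]:
  assumes "h \<in> carrier H" shows "h \<diamondop> \<^bold>0\<^bsub>I\<^esub> = \<^bold>0\<^bsub>I\<^esub>"
  using dia_add[of h "\<^bold>0\<^bsub>I\<^esub>" "\<^bold>0\<^bsub>I\<^esub>"] assms by simp

lemma carrier_ext [simp]: "carrier B = carrier I \<times> carrier H"
  by (simp add: ext_prod_def)

lemma zero_ext [simp]: "\<^bold>0\<^bsub>B\<^esub> = (\<^bold>0\<^bsub>I\<^esub>, \<^bold>0\<^bsub>H\<^esub>)"
  by (simp add: ext_prod_def)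

lemma add_ext [simp]: "(y, h) \<^bold>+\<^bsub>B\<^esub> (y', h') = (y \<^bold>+\<^bsub>I\<^esub> y' \<^bold>+\<^bsub>I\<^esub> \<beta> h h', h \<^bold>+\<^bsub>H\<^esub> h')"
  by (simp add: ext_prod_def)

text \<open>The middle summand of the defining formula is
  \<open>(h \<diamondop> y) \<cdot> f h h'\<close>; it collapses because \<open>f h h'\<close> is
  central.\<close>

lemma dot_ext [simp]:
  assumes "y \<in> carrier I" "h \<in> carrier H" "h' \<in> carrier H"
  shows "(y, h) \<cdot>\<^bsub>B\<^esub> (y', h') =
    ((h \<diamondop> y) \<cdot>\<^bsub>I\<^esub> (h \<diamondop> y') \<^bold>+\<^bsub>I\<^esub> f h h' \<^bold>+\<^bsub>I\<^esub> (h \<diamondop> y) \<leftthreetimes> (h \<cdot>\<^bsub>H\<^esub> h'), h \<cdot>\<^bsub>H\<^esub> h')"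
  using assms by (simp add: ext_prod_def)

text \<open>Right distributivity of \<open>I\<close> produces the same summand \<open>?c\<close> on
  both sides. Once it is cancelled, \<open>y'\<close> and \<open>y''\<close> are gone and only
  central terms remain.\<close>

lemma dot_add_right_ext_iff:
  assumes [simp]: "y \<in> carrier I" "y' \<in> carrier I" "y'' \<in> carrier I"
    "h \<in> carrier H" "h' \<in> carrier H" "h'' \<in> carrier H"
  shows "(y, h) \<cdot>\<^bsub>B\<^esub> ((y', h') \<^bold>+\<^bsub>B\<^esub> (y'', h''))
      = (y, h) \<cdot>\<^bsub>B\<^esub> (y', h') \<^bold>+\<^bsub>B\<^esub> (y, h) \<cdot>\<^bsub>B\<^esub> (y'', h'') \<longleftrightarrow>
    h \<diamondop> \<beta> h' h'' \<^bold>+\<^bsub>I\<^esub> f h (h' \<^bold>+\<^bsub>H\<^esub> h'') \<^bold>+\<^bsub>I\<^esub> (h \<diamondop> y) \<leftthreetimes> (h \<cdot>\<^bsub>H\<^esub> h' \<^bold>+\<^bsub>H\<^esub> h \<cdot>\<^bsub>H\<^esub> h'')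
      = f h h' \<^bold>+\<^bsub>I\<^esub> f h h'' \<^bold>+\<^bsub>I\<^esub> \<beta> (h \<cdot>\<^bsub>H\<^esub> h') (h \<cdot>\<^bsub>H\<^esub> h'')
        \<^bold>+\<^bsub>I\<^esub> ((h \<diamondop> y) \<leftthreetimes> (h \<cdot>\<^bsub>H\<^esub> h') \<^bold>+\<^bsub>I\<^esub> (h \<diamondop> y) \<leftthreetimes> (h \<cdot>\<^bsub>H\<^esub> h''))"
    (is "?l = ?r \<longleftrightarrow> ?L = ?R")
proof -
  let ?c = "(h \<diamondop> y) \<cdot>\<^bsub>I\<^esub> (h \<diamondop> y') \<^bold>+\<^bsub>I\<^esub> (h \<diamondop> y) \<cdot>\<^bsub>I\<^esub> (h \<diamondop> y'')"
  let ?k = "h \<cdot>\<^bsub>H\<^esub> h' \<^bold>+\<^bsub>H\<^esub> h \<cdot>\<^bsub>H\<^esub> h''"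
  have l: "?l = (?c \<^bold>+\<^bsub>I\<^esub> ?L, ?k)"
    by (simp add: dia_add I.dot_add_right H.dot_add_right I.m_ac)
  have r: "?r = (?c \<^bold>+\<^bsub>I\<^esub> ?R, ?k)"
    by (simp add: I.m_ac)
  show ?thesis unfolding l r prod.inject by simp
qed

lemma dot_add_left_ext_iff:
  fixes h h' h'' y y' y''
  defines "s \<equiv> h \<^bold>+\<^bsub>H\<^esub> h'" and "p \<equiv> h \<cdot>\<^bsub>H\<^esub> h'" and "q \<equiv> h \<cdot>\<^bsub>H\<^esub> h''"
  assumes [simp]: "y \<in> carrier I" "y' \<in> carrier I" "y'' \<in> carrier I"
    "h \<in> carrier H" "h' \<in> carrier H" "h'' \<in> carrier H"
  shows "((y, h) \<^bold>+\<^bsub>B\<^esub> (y', h')) \<cdot>\<^bsub>B\<^esub> (y'', h'')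
      = ((y, h) \<cdot>\<^bsub>B\<^esub> (y', h')) \<cdot>\<^bsub>B\<^esub> ((y, h) \<cdot>\<^bsub>B\<^esub> (y'', h'')) \<longleftrightarrow>
    (s \<diamondop> y \<^bold>+\<^bsub>I\<^esub> s \<diamondop> y') \<cdot>\<^bsub>I\<^esub> (s \<diamondop> y'') \<^bold>+\<^bsub>I\<^esub> f s h''
        \<^bold>+\<^bsub>I\<^esub> (s \<diamondop> y \<^bold>+\<^bsub>I\<^esub> s \<diamondop> y' \<^bold>+\<^bsub>I\<^esub> s \<diamondop> \<beta> h h') \<leftthreetimes> (s \<cdot>\<^bsub>H\<^esub> h'')
      = (p \<diamondop> ((h \<diamondop> y) \<cdot>\<^bsub>I\<^esub> (h \<diamondop> y'))) \<cdot>\<^bsub>I\<^esub> (p \<diamondop> ((h \<diamondop> y) \<cdot>\<^bsub>I\<^esub> (h \<diamondop> y'')))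
        \<^bold>+\<^bsub>I\<^esub> p \<diamondop> f h h'' \<^bold>+\<^bsub>I\<^esub> p \<diamondop> ((h \<diamondop> y) \<leftthreetimes> q) \<^bold>+\<^bsub>I\<^esub> f p q
        \<^bold>+\<^bsub>I\<^esub> (p \<diamondop> ((h \<diamondop> y) \<cdot>\<^bsub>I\<^esub> (h \<diamondop> y')) \<^bold>+\<^bsub>I\<^esub> p \<diamondop> f h h' \<^bold>+\<^bsub>I\<^esub> p \<diamondop> ((h \<diamondop> y) \<leftthreetimes> p))
          \<leftthreetimes> (p \<cdot>\<^bsub>H\<^esub> q)"
    (is "?l = ?r \<longleftrightarrow> ?L = ?R")
proof -
  have [simp]: "s \<in> carrier H" "p \<in> carrier H" "q \<in> carrier H"
    by (simp_all add: s_def p_def q_def)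
  have k: "s \<cdot>\<^bsub>H\<^esub> h'' = p \<cdot>\<^bsub>H\<^esub> q"
    by (simp add: s_def p_def q_def H.dot_add_left)
  have l: "?l = (?L, p \<cdot>\<^bsub>H\<^esub> q)"
    by (simp add: s_def[symmetric] k dia_add)
  have r: "?r = (?R, p \<cdot>\<^bsub>H\<^esub> q)"
    by (simp add: p_def[symmetric] q_def[symmetric] dia_add I.dot_add_right I.m_assoc)
  show ?thesis unfolding l r prod.inject by simp
qed

end

section \<open>Sufficiency: the conditions make the product an extension\<close>

text \<open>Holds the conditions of the equivalence as separate rules: one direction works inside
  this locale, the other has to establish it.\<close>

locale extension_cocycle = extension_datum +
  assumes dia_bij: "h \<in> carrier H \<Longrightarrow> bij_betw (\<lambda>y. h \<diamondop> y) (carrier I) (carrier I)"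
    and \<beta>_cocycle: "\<lbrakk>h \<in> carrier H; h' \<in> carrier H; h'' \<in> carrier H\<rbrakk>
      \<Longrightarrow> \<beta> h h' \<^bold>+\<^bsub>I\<^esub> \<beta> (h \<^bold>+\<^bsub>H\<^esub> h') h'' = \<beta> h' h'' \<^bold>+\<^bsub>I\<^esub> \<beta> h (h' \<^bold>+\<^bsub>H\<^esub> h'')"
    and \<beta>_zero_right [simp]: "h \<in> carrier H \<Longrightarrow> \<beta> h \<^bold>0\<^bsub>H\<^esub> = \<^bold>0\<^bsub>I\<^esub>"
    and \<beta>_zero_left [simp]: "h \<in> carrier H \<Longrightarrow> \<beta> \<^bold>0\<^bsub>H\<^esub> h = \<^bold>0\<^bsub>I\<^esub>"
    and \<beta>_commute: "\<lbrakk>h \<in> carrier H; h' \<in> carrier H\<rbrakk> \<Longrightarrow> \<beta> h h' = \<beta> h' h"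
    and f_add_right: "\<lbrakk>h \<in> carrier H; h' \<in> carrier H; h'' \<in> carrier H\<rbrakk>
      \<Longrightarrow> (h \<diamondop> \<beta> h' h'') \<^bold>+\<^bsub>I\<^esub> f h (h' \<^bold>+\<^bsub>H\<^esub> h'')
        = f h h' \<^bold>+\<^bsub>I\<^esub> f h h'' \<^bold>+\<^bsub>I\<^esub> \<beta> (h \<cdot>\<^bsub>H\<^esub> h') (h \<cdot>\<^bsub>H\<^esub> h'')"
    and tri_add_right: "\<lbrakk>y \<in> carrier I; h \<in> carrier H; h' \<in> carrier H\<rbrakk>
      \<Longrightarrow> y \<leftthreetimes> (h \<^bold>+\<^bsub>H\<^esub> h') = (y \<leftthreetimes> h) \<^bold>+\<^bsub>I\<^esub> (y \<leftthreetimes> h')"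
    and dia_dot: "\<lbrakk>h \<in> carrier H; y \<in> carrier I; y' \<in> carrier I\<rbrakk>
      \<Longrightarrow> (h \<diamondop> y) \<cdot>\<^bsub>I\<^esub> (h \<diamondop> y') = h \<diamondop> (y \<cdot>\<^bsub>I\<^esub> y')"
    and add_dia: "\<lbrakk>h \<in> carrier H; h' \<in> carrier H; y \<in> carrier I\<rbrakk>
      \<Longrightarrow> (h \<^bold>+\<^bsub>H\<^esub> h') \<diamondop> y = (h \<cdot>\<^bsub>H\<^esub> h') \<diamondop> (h \<diamondop> y)"
    and tri_add_left: "\<lbrakk>y \<in> carrier I; y' \<in> carrier I; h \<in> carrier H\<rbrakk>
      \<Longrightarrow> (y \<^bold>+\<^bsub>I\<^esub> y') \<leftthreetimes> h = (y \<leftthreetimes> h) \<^bold>+\<^bsub>I\<^esub> ((y \<cdot>\<^bsub>I\<^esub> y') \<leftthreetimes> h)"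
    and dia_tri: "\<lbrakk>h \<in> carrier H; h' \<in> carrier H; y \<in> carrier I\<rbrakk>
      \<Longrightarrow> (h \<diamondop> y) \<leftthreetimes> (h \<cdot>\<^bsub>H\<^esub> h')
        = (h \<diamondop> (y \<leftthreetimes> h')) \<^bold>+\<^bsub>I\<^esub> ((h \<diamondop> (y \<leftthreetimes> h)) \<leftthreetimes> (h \<cdot>\<^bsub>H\<^esub> h'))"
    and f_add_left: "\<lbrakk>h \<in> carrier H; h' \<in> carrier H; h'' \<in> carrier H\<rbrakk>
      \<Longrightarrow> f (h \<^bold>+\<^bsub>H\<^esub> h') h'' \<^bold>+\<^bsub>I\<^esub> (((h \<^bold>+\<^bsub>H\<^esub> h') \<diamondop> \<beta> h h') \<leftthreetimes> ((h \<^bold>+\<^bsub>H\<^esub> h') \<cdot>\<^bsub>H\<^esub> h''))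
        = ((h \<cdot>\<^bsub>H\<^esub> h') \<diamondop> f h h'') \<^bold>+\<^bsub>I\<^esub> f (h \<cdot>\<^bsub>H\<^esub> h') (h \<cdot>\<^bsub>H\<^esub> h'')
          \<^bold>+\<^bsub>I\<^esub> (((h \<cdot>\<^bsub>H\<^esub> h') \<diamondop> f h h') \<leftthreetimes> ((h \<cdot>\<^bsub>H\<^esub> h') \<cdot>\<^bsub>H\<^esub> (h \<cdot>\<^bsub>H\<^esub> h'')))"
begin

text \<open>For central \<open>z\<close> the twisted term
  \<open>(y \<cdot> z) \<leftthreetimes> h\<close> of \<open>tri_add_left\<close> is just
  \<open>z \<leftthreetimes> h\<close>.\<close>

lemma add_center_tri:
  assumes "y \<in> carrier I" "z \<in> lcs_center I" "h \<in> carrier H"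
  shows "(y \<^bold>+\<^bsub>I\<^esub> z) \<leftthreetimes> h = (y \<leftthreetimes> h) \<^bold>+\<^bsub>I\<^esub> (z \<leftthreetimes> h)"
  using tri_add_left[of y z h] assms by simp

text \<open>The classical abelian extension by a normalized symmetric 2-cocycle: the cocycle
  identity gives associativity, symmetry gives commutativity, and normalization makes
  \<open>(0, 0)\<close> neutral.\<close>

lemma ext_comm_group: "comm_group B"
proof (rule comm_groupI)
  fix X Y Z assume "X \<in> carrier B" "Y \<in> carrier B" "Z \<in> carrier B"
  then obtain y h y' h' y'' h'' where eq: "X = (y, h)" "Y = (y', h')" "Z = (y'', h'')"
    and [simp]: "y \<in> carrier I" "y' \<in> carrier I" "y'' \<in> carrier I"
      "h \<in> carrier H" "h' \<in> carrier H" "h'' \<in> carrier H"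
    by auto
  have "y \<^bold>+\<^bsub>I\<^esub> y' \<^bold>+\<^bsub>I\<^esub> \<beta> h h' \<^bold>+\<^bsub>I\<^esub> y'' \<^bold>+\<^bsub>I\<^esub> \<beta> (h \<^bold>+\<^bsub>H\<^esub> h') h''
      = y \<^bold>+\<^bsub>I\<^esub> y' \<^bold>+\<^bsub>I\<^esub> y'' \<^bold>+\<^bsub>I\<^esub> (\<beta> h h' \<^bold>+\<^bsub>I\<^esub> \<beta> (h \<^bold>+\<^bsub>H\<^esub> h') h'')"
    by (simp add: I.m_ac)
  also have "\<dots> = y \<^bold>+\<^bsub>I\<^esub> (y' \<^bold>+\<^bsub>I\<^esub> y'' \<^bold>+\<^bsub>I\<^esub> \<beta> h' h'') \<^bold>+\<^bsub>I\<^esub> \<beta> h (h' \<^bold>+\<^bsub>H\<^esub> h'')"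
    unfolding \<beta>_cocycle[OF \<open>h \<in> _\<close> \<open>h' \<in> _\<close> \<open>h'' \<in> _\<close>] by (simp add: I.m_ac)
  finally show "X \<^bold>+\<^bsub>B\<^esub> Y \<^bold>+\<^bsub>B\<^esub> Z = X \<^bold>+\<^bsub>B\<^esub> (Y \<^bold>+\<^bsub>B\<^esub> Z)"
    by (simp add: eq H.m_assoc)
next
  fix X assume "X \<in> carrier B"
  then obtain y h where eq: "X = (y, h)" and [simp]: "y \<in> carrier I" "h \<in> carrier H"
    by auto
  \<comment> \<open>Adding \<open>(inv h, h)\<close> in the second component contributes the value
    \<open>\<beta> (inv h) h\<close> to the first, so the inverse has to compensate it along with
    \<open>y\<close>.\<close>
  let ?y' = "inv\<^bsub>I\<^esub> (y \<^bold>+\<^bsub>I\<^esub> \<beta> (inv\<^bsub>H\<^esub> h) h)"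
  have "?y' \<^bold>+\<^bsub>I\<^esub> y \<^bold>+\<^bsub>I\<^esub> \<beta> (inv\<^bsub>H\<^esub> h) h = \<^bold>0\<^bsub>I\<^esub>"
    by (simp add: I.m_assoc I.l_inv del: I.inv_mult_group)
  then show "\<exists>Y\<in>carrier B. Y \<^bold>+\<^bsub>B\<^esub> X = \<^bold>0\<^bsub>B\<^esub>"
    by (intro bexI[of _ "(?y', inv\<^bsub>H\<^esub> h)"]) (simp_all add: eq)
qed (auto simp: I.m_comm H.m_comm \<beta>_commute)

lemma f_zero_right [simp]:
  assumes "h \<in> carrier H" shows "f h \<^bold>0\<^bsub>H\<^esub> = \<^bold>0\<^bsub>I\<^esub>"
  using f_add_right[of h "\<^bold>0\<^bsub>H\<^esub>" "\<^bold>0\<^bsub>H\<^esub>"] assms by simp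

text \<open>The part built from products in \<open>I\<close> agrees by left distributivity of
  \<open>I\<close>, carried over by \<open>add_dia\<close> and \<open>dia_dot\<close>. The central
  part splits by additivity of \<open>\<leftthreetimes>\<close> into an instance of
  \<open>f_add_left\<close>, an instance of \<open>dia_tri\<close> and the term
  \<open>?w \<leftthreetimes> k\<close> common to both sides.\<close>

lemma dot_add_left_ext:
  assumes [simp]: "y \<in> carrier I" "y' \<in> carrier I" "y'' \<in> carrier I"
    "h \<in> carrier H" "h' \<in> carrier H" "h'' \<in> carrier H"
  shows "((y, h) \<^bold>+\<^bsub>B\<^esub> (y', h')) \<cdot>\<^bsub>B\<^esub> (y'', h'')
      = ((y, h) \<cdot>\<^bsub>B\<^esub> (y', h')) \<cdot>\<^bsub>B\<^esub> ((y, h) \<cdot>\<^bsub>B\<^esub> (y'', h''))"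
proof -
  define s p q k where "s = h \<^bold>+\<^bsub>H\<^esub> h'" and "p = h \<cdot>\<^bsub>H\<^esub> h'" and "q = h \<cdot>\<^bsub>H\<^esub> h''"
    and "k = p \<cdot>\<^bsub>H\<^esub> q"
  have [simp]: "s \<in> carrier H" "p \<in> carrier H" "q \<in> carrier H" "k \<in> carrier H"
    by (simp_all add: s_def p_def q_def k_def)
  have k: "s \<cdot>\<^bsub>H\<^esub> h'' = k" by (simp add: s_def p_def q_def k_def H.dot_add_left)
  have sp: "p \<diamondop> (h \<diamondop> x) = s \<diamondop> x" if "x \<in> carrier I" for x
    using add_dia[of h h' x] that by (simp add: s_def p_def)
  let ?w = "(s \<diamondop> y) \<cdot>\<^bsub>I\<^esub> (s \<diamondop> y')"
  have w: "p \<diamondop> ((h \<diamondop> y) \<cdot>\<^bsub>I\<^esub> (h \<diamondop> x)) = (s \<diamondop> y) \<cdot>\<^bsub>I\<^esub> (s \<diamondop> x)" if "x \<in> carrier I" for x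
    using that by (simp add: dia_dot[symmetric] sp)
  \<comment> \<open>The grouping is chosen so that the first bracket is the left side of
    \<open>f_add_left\<close> and \<open>(s \<diamondop> y) \<leftthreetimes> k\<close> is the left
    side of \<open>dia_tri\<close> at \<open>p\<close>, \<open>q\<close>,
    \<open>h \<diamondop> y\<close>.\<close>
  have "f s h'' \<^bold>+\<^bsub>I\<^esub> (s \<diamondop> y \<^bold>+\<^bsub>I\<^esub> s \<diamondop> y' \<^bold>+\<^bsub>I\<^esub> s \<diamondop> \<beta> h h') \<leftthreetimes> k
      = (f s h'' \<^bold>+\<^bsub>I\<^esub> (s \<diamondop> \<beta> h h') \<leftthreetimes> k) \<^bold>+\<^bsub>I\<^esub> ((s \<diamondop> y) \<leftthreetimes> k \<^bold>+\<^bsub>I\<^esub> ?w \<leftthreetimes> k)"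
    by (subst add_center_tri) (simp_all add: tri_add_left I.m_ac)
  also have "f s h'' \<^bold>+\<^bsub>I\<^esub> (s \<diamondop> \<beta> h h') \<leftthreetimes> k = p \<diamondop> f h h'' \<^bold>+\<^bsub>I\<^esub> f p q \<^bold>+\<^bsub>I\<^esub> (p \<diamondop> f h h') \<leftthreetimes> k"
    using f_add_left[of h h' h''] by (simp add: s_def[symmetric] p_def[symmetric] q_def[symmetric] k k_def)
  also have "(s \<diamondop> y) \<leftthreetimes> k = p \<diamondop> ((h \<diamondop> y) \<leftthreetimes> q) \<^bold>+\<^bsub>I\<^esub> (p \<diamondop> ((h \<diamondop> y) \<leftthreetimes> p)) \<leftthreetimes> k"
    using dia_tri[of p q "h \<diamondop> y"] by (simp add: sp k_def)
  \<comment> \<open>\<open>add_center_tri\<close> is now used to split the first argument of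
    \<open>\<leftthreetimes>\<close> on the right, where two of the three summands are
    central.\<close>
  finally have "f s h'' \<^bold>+\<^bsub>I\<^esub> (s \<diamondop> y \<^bold>+\<^bsub>I\<^esub> s \<diamondop> y' \<^bold>+\<^bsub>I\<^esub> s \<diamondop> \<beta> h h') \<leftthreetimes> k
      = p \<diamondop> f h h'' \<^bold>+\<^bsub>I\<^esub> p \<diamondop> ((h \<diamondop> y) \<leftthreetimes> q) \<^bold>+\<^bsub>I\<^esub> f p q
        \<^bold>+\<^bsub>I\<^esub> (?w \<^bold>+\<^bsub>I\<^esub> p \<diamondop> f h h' \<^bold>+\<^bsub>I\<^esub> p \<diamondop> ((h \<diamondop> y) \<leftthreetimes> p)) \<leftthreetimes> k"
    by (subst add_center_tri, simp_all)+ (simp add: I.m_ac)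
  moreover have "(s \<diamondop> y \<^bold>+\<^bsub>I\<^esub> s \<diamondop> y') \<cdot>\<^bsub>I\<^esub> (s \<diamondop> y'') = ?w \<cdot>\<^bsub>I\<^esub> ((s \<diamondop> y) \<cdot>\<^bsub>I\<^esub> (s \<diamondop> y''))"
    by (simp add: I.dot_add_left)
  ultimately show ?thesis
    unfolding dot_add_left_ext_iff[OF assms] s_def[symmetric] p_def[symmetric] q_def[symmetric]
      k_def[symmetric] k
    by (simp add: w I.m_assoc)
qed

text \<open>The map is triangular: its second component depends on \<open>h'\<close> only, and for
  fixed \<open>h'\<close> the first is the bijection sending \<open>y'\<close> to
  \<open>(h \<diamondop> y) \<cdot> (h \<diamondop> y')\<close>, followed by a translation.\<close>

lemma dot_bij_ext:
  assumes [simp]: "y \<in> carrier I" "h \<in> carrier H"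
  shows "bij_betw (\<lambda>Y. (y, h) \<cdot>\<^bsub>B\<^esub> Y) (carrier B) (carrier B)"
proof (rule bij_betwI')
  fix X Y assume "X \<in> carrier B" "Y \<in> carrier B"
  then obtain y' h' y'' h'' where eq: "X = (y', h')" "Y = (y'', h'')"
    and [simp]: "y' \<in> carrier I" "y'' \<in> carrier I" "h' \<in> carrier H" "h'' \<in> carrier H"
    by auto
  have "h \<cdot>\<^bsub>H\<^esub> h' = h \<cdot>\<^bsub>H\<^esub> h'' \<longleftrightarrow> h' = h''"
    by (simp add: inj_on_eq_iff[OF bij_betw_imp_inj_on[OF H.dot_bij]])
  moreover have "(h \<diamondop> y) \<cdot>\<^bsub>I\<^esub> (h \<diamondop> y') = (h \<diamondop> y) \<cdot>\<^bsub>I\<^esub> (h \<diamondop> y'') \<longleftrightarrow> y' = y''"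
    by (simp add: inj_on_eq_iff[OF bij_betw_imp_inj_on[OF I.dot_bij]]
        inj_on_eq_iff[OF bij_betw_imp_inj_on[OF dia_bij]])
  ultimately show "(y, h) \<cdot>\<^bsub>B\<^esub> X = (y, h) \<cdot>\<^bsub>B\<^esub> Y \<longleftrightarrow> X = Y"
    by (auto simp: eq I.m_assoc)
next
  fix X assume "X \<in> carrier B"
  then show "(y, h) \<cdot>\<^bsub>B\<^esub> X \<in> carrier B" by auto
next
  fix X assume "X \<in> carrier B"
  then obtain x k where eq: "X = (x, k)" and [simp]: "x \<in> carrier I" "k \<in> carrier H"
    by auto
  obtain h' where [simp]: "h' \<in> carrier H" and h': "h \<cdot>\<^bsub>H\<^esub> h' = k"
    using H.dot_bij[of h] \<open>k \<in> carrier H\<close> assms(2) by (metis bij_betw_imp_surj_on imageE)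
  \<comment> \<open>The translation constant belonging to \<open>h'\<close>. A preimage of
    \<open>x\<close> is found by subtracting \<open>c\<close> and then inverting first
    multiplication by \<open>h \<diamondop> y\<close> and next the action of
    \<open>h\<close>.\<close>
  define c where "c = f h h' \<^bold>+\<^bsub>I\<^esub> (h \<diamondop> y) \<leftthreetimes> k"
  have [simp]: "c \<in> carrier I" by (simp add: c_def)
  obtain u where [simp]: "u \<in> carrier I" and u: "(h \<diamondop> y) \<cdot>\<^bsub>I\<^esub> u = x \<^bold>+\<^bsub>I\<^esub> inv\<^bsub>I\<^esub> c"
    using I.dot_bij[of "h \<diamondop> y"]
    by (metis \<open>c \<in> carrier I\<close> \<open>x \<in> carrier I\<close> I.inv_closed I.m_closed assms bij_betw_imp_surj_on
        dia_closed imageE)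
  obtain y' where [simp]: "y' \<in> carrier I" and y': "h \<diamondop> y' = u"
    using dia_bij[of h] \<open>u \<in> carrier I\<close> assms(2) by (metis bij_betw_imp_surj_on imageE)
  have "(y, h) \<cdot>\<^bsub>B\<^esub> (y', h') = (x \<^bold>+\<^bsub>I\<^esub> inv\<^bsub>I\<^esub> c \<^bold>+\<^bsub>I\<^esub> c, k)"
    by (simp add: h' y' u) (simp add: c_def I.m_assoc)
  also have "\<dots> = X"
    by (simp add: eq I.m_assoc)
  finally show "\<exists>Y\<in>carrier B. X = (y, h) \<cdot>\<^bsub>B\<^esub> Y"
    by (intro bexI[of _ "(y', h')"]) (rule sym, simp_all del: dot_ext)
qed

lemma ext_linear_cycle_set: "linear_cycle_set B"
proof (intro linear_cycle_set.intro linear_cycle_set_axioms.intro ext_comm_group)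
  fix X assume "X \<in> carrier B"
  then show "bij_betw (\<lambda>Y. X \<cdot>\<^bsub>B\<^esub> Y) (carrier B) (carrier B)"
    using dot_bij_ext by auto
next
  fix X Y Z assume "X \<in> carrier B" "Y \<in> carrier B" "Z \<in> carrier B"
  then obtain y h y' h' y'' h'' where eq: "X = (y, h)" "Y = (y', h')" "Z = (y'', h'')"
    and mem: "y \<in> carrier I" "y' \<in> carrier I" "y'' \<in> carrier I"
      "h \<in> carrier H" "h' \<in> carrier H" "h'' \<in> carrier H"
    by auto
  show "X \<cdot>\<^bsub>B\<^esub> (Y \<^bold>+\<^bsub>B\<^esub> Z) = X \<cdot>\<^bsub>B\<^esub> Y \<^bold>+\<^bsub>B\<^esub> X \<cdot>\<^bsub>B\<^esub> Z"
    unfolding eq dot_add_right_ext_iff[OF mem] using mem by (simp add: f_add_right tri_add_right)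
  show "(X \<^bold>+\<^bsub>B\<^esub> Y) \<cdot>\<^bsub>B\<^esub> Z = (X \<cdot>\<^bsub>B\<^esub> Y) \<cdot>\<^bsub>B\<^esub> (X \<cdot>\<^bsub>B\<^esub> Z)"
    unfolding eq by (rule dot_add_left_ext[OF mem])
qed

text \<open>Exactness is read off the formulas. That \<open>y \<mapsto> (y, 0)\<close> is a morphism
  rests on \<open>\<beta> 0 0 = 0\<close>, \<open>f 0 0 = 0\<close> and
  \<open>y \<leftthreetimes> 0 = 0\<close>.\<close>

lemma ext_lcs_extension: "lcs_extension I B H (\<lambda>y. (y, \<^bold>0\<^bsub>H\<^esub>)) (\<lambda>(y, h). h)"
  unfolding lcs_extension_def
  using ext_linear_cycle_set I.linear_cycle_set_axioms H.linear_cycle_set_axioms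
  by (auto simp: lcs_hom_def hom_def mon_def epi_def kernel_def inj_on_def image_iff)

end

section \<open>Necessity: the axioms of the product force the conditions\<close>

context extension_datum
begin

text \<open>Each condition is an axiom of \<open>B\<close> at suitable pairs. The order matters:
  \<open>\<beta>0\<close> leads to \<open>f0r\<close> and, with it, to \<open>f0l\<close>, and these
  clear the unwanted terms from the later instances.\<close>

lemma extension_cocycle_of_linear_cycle_set:
  assumes "linear_cycle_set B"
  shows "extension_cocycle I H (\<diamondop>) (\<leftthreetimes>) \<beta> f"
proof -
  interpret B: linear_cycle_set B by fact
  note [simp del] = B.m_closed B.dot_closed
  \<comment> \<open>Taking \<open>0\<close> for \<open>y'\<close> and \<open>y''\<close> loses
    nothing, since the reduced equation does not contain them.\<close>
  have right: "h \<diamondop> \<beta> h' h'' \<^bold>+\<^bsub>I\<^esub> f h (h' \<^bold>+\<^bsub>H\<^esub> h'') \<^bold>+\<^bsub>I\<^esub> (h \<diamondop> y) \<leftthreetimes> (h \<cdot>\<^bsub>H\<^esub> h' \<^bold>+\<^bsub>H\<^esub> h \<cdot>\<^bsub>H\<^esub> h'')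
      = f h h' \<^bold>+\<^bsub>I\<^esub> f h h'' \<^bold>+\<^bsub>I\<^esub> \<beta> (h \<cdot>\<^bsub>H\<^esub> h') (h \<cdot>\<^bsub>H\<^esub> h'')
        \<^bold>+\<^bsub>I\<^esub> ((h \<diamondop> y) \<leftthreetimes> (h \<cdot>\<^bsub>H\<^esub> h') \<^bold>+\<^bsub>I\<^esub> (h \<diamondop> y) \<leftthreetimes> (h \<cdot>\<^bsub>H\<^esub> h''))"
    if "y \<in> carrier I" "h \<in> carrier H" "h' \<in> carrier H" "h'' \<in> carrier H" for y h h' h''
    using B.dot_add_right[of "(y, h)" "(\<^bold>0\<^bsub>I\<^esub>, h')" "(\<^bold>0\<^bsub>I\<^esub>, h'')"] that
    by (subst dot_add_right_ext_iff[symmetric, OF _ I.one_closed I.one_closed]) auto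
  have left: "(s \<diamondop> y \<^bold>+\<^bsub>I\<^esub> s \<diamondop> y') \<cdot>\<^bsub>I\<^esub> (s \<diamondop> y'') \<^bold>+\<^bsub>I\<^esub> f s h''
        \<^bold>+\<^bsub>I\<^esub> (s \<diamondop> y \<^bold>+\<^bsub>I\<^esub> s \<diamondop> y' \<^bold>+\<^bsub>I\<^esub> s \<diamondop> \<beta> h h') \<leftthreetimes> (s \<cdot>\<^bsub>H\<^esub> h'')
      = (p \<diamondop> ((h \<diamondop> y) \<cdot>\<^bsub>I\<^esub> (h \<diamondop> y'))) \<cdot>\<^bsub>I\<^esub> (p \<diamondop> ((h \<diamondop> y) \<cdot>\<^bsub>I\<^esub> (h \<diamondop> y'')))
        \<^bold>+\<^bsub>I\<^esub> p \<diamondop> f h h'' \<^bold>+\<^bsub>I\<^esub> p \<diamondop> ((h \<diamondop> y) \<leftthreetimes> q) \<^bold>+\<^bsub>I\<^esub> f p q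
        \<^bold>+\<^bsub>I\<^esub> (p \<diamondop> ((h \<diamondop> y) \<cdot>\<^bsub>I\<^esub> (h \<diamondop> y')) \<^bold>+\<^bsub>I\<^esub> p \<diamondop> f h h' \<^bold>+\<^bsub>I\<^esub> p \<diamondop> ((h \<diamondop> y) \<leftthreetimes> p))
          \<leftthreetimes> (p \<cdot>\<^bsub>H\<^esub> q)"
    if "y \<in> carrier I" "y' \<in> carrier I" "y'' \<in> carrier I"
      "h \<in> carrier H" "h' \<in> carrier H" "h'' \<in> carrier H"
      "s = h \<^bold>+\<^bsub>H\<^esub> h'" "p = h \<cdot>\<^bsub>H\<^esub> h'" "q = h \<cdot>\<^bsub>H\<^esub> h''" for y y' y'' h h' h'' s p q
    using B.dot_add_left[of "(y, h)" "(y', h')" "(y'', h'')"] dot_add_left_ext_iff[OF that(1-6)] that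
    by auto

  have \<beta>0: "\<beta> h \<^bold>0\<^bsub>H\<^esub> = \<^bold>0\<^bsub>I\<^esub>" "\<beta> \<^bold>0\<^bsub>H\<^esub> h = \<^bold>0\<^bsub>I\<^esub>" if "h \<in> carrier H" for h
    using B.r_one[of "(\<^bold>0\<^bsub>I\<^esub>, h)"] B.l_one[of "(\<^bold>0\<^bsub>I\<^esub>, h)"] that by auto
  have f_right: "h \<diamondop> \<beta> h' h'' \<^bold>+\<^bsub>I\<^esub> f h (h' \<^bold>+\<^bsub>H\<^esub> h'')
      = f h h' \<^bold>+\<^bsub>I\<^esub> f h h'' \<^bold>+\<^bsub>I\<^esub> \<beta> (h \<cdot>\<^bsub>H\<^esub> h') (h \<cdot>\<^bsub>H\<^esub> h'')"
    if "h \<in> carrier H" "h' \<in> carrier H" "h'' \<in> carrier H" for h h' h''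
    using right[of "\<^bold>0\<^bsub>I\<^esub>" h h' h''] that by simp
  have f0r [simp]: "f h \<^bold>0\<^bsub>H\<^esub> = \<^bold>0\<^bsub>I\<^esub>" if "h \<in> carrier H" for h
    using f_right[of h "\<^bold>0\<^bsub>H\<^esub>" "\<^bold>0\<^bsub>H\<^esub>"] that by (simp add: \<beta>0)
  have f_left: "f (h \<^bold>+\<^bsub>H\<^esub> h') h'' \<^bold>+\<^bsub>I\<^esub> ((h \<^bold>+\<^bsub>H\<^esub> h') \<diamondop> \<beta> h h') \<leftthreetimes> ((h \<^bold>+\<^bsub>H\<^esub> h') \<cdot>\<^bsub>H\<^esub> h'')
        = (h \<cdot>\<^bsub>H\<^esub> h') \<diamondop> f h h'' \<^bold>+\<^bsub>I\<^esub> f (h \<cdot>\<^bsub>H\<^esub> h') (h \<cdot>\<^bsub>H\<^esub> h'')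
          \<^bold>+\<^bsub>I\<^esub> ((h \<cdot>\<^bsub>H\<^esub> h') \<diamondop> f h h') \<leftthreetimes> ((h \<cdot>\<^bsub>H\<^esub> h') \<cdot>\<^bsub>H\<^esub> (h \<cdot>\<^bsub>H\<^esub> h''))"
    if "h \<in> carrier H" "h' \<in> carrier H" "h'' \<in> carrier H" for h h' h''
    using left[of "\<^bold>0\<^bsub>I\<^esub>" "\<^bold>0\<^bsub>I\<^esub>" "\<^bold>0\<^bsub>I\<^esub>" h h' h'', OF _ _ _ _ _ _ refl refl refl] that by simp
  \<comment> \<open>Here \<open>f_left\<close> reads \<open>f 0 h = f 0 h + f 0 h\<close>, because
    the \<open>\<leftthreetimes>\<close>-terms have first arguments \<open>\<beta> 0 0\<close> and
    \<open>f 0 0\<close>, both zero.\<close>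
  have f0l [simp]: "f \<^bold>0\<^bsub>H\<^esub> h = \<^bold>0\<^bsub>I\<^esub>" if "h \<in> carrier H" for h
    using f_left[of "\<^bold>0\<^bsub>H\<^esub>" "\<^bold>0\<^bsub>H\<^esub>" h] that by (simp add: \<beta>0)
  \<comment> \<open>Left distributivity at \<open>(y, 0)\<close>, \<open>(y', h)\<close>, \<open>(y'', h'')\<close>; the conditions
    involving both \<open>I\<close> and \<open>H\<close> come from setting further arguments to zero.\<close>
  have left0: "(h \<diamondop> y \<^bold>+\<^bsub>I\<^esub> h \<diamondop> y') \<cdot>\<^bsub>I\<^esub> (h \<diamondop> y'') \<^bold>+\<^bsub>I\<^esub> f h h''
        \<^bold>+\<^bsub>I\<^esub> (h \<diamondop> y \<^bold>+\<^bsub>I\<^esub> h \<diamondop> y') \<leftthreetimes> (h \<cdot>\<^bsub>H\<^esub> h'')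
      = (h \<diamondop> (y \<cdot>\<^bsub>I\<^esub> y')) \<cdot>\<^bsub>I\<^esub> (h \<diamondop> (y \<cdot>\<^bsub>I\<^esub> y''))
        \<^bold>+\<^bsub>I\<^esub> h \<diamondop> (y \<leftthreetimes> h'') \<^bold>+\<^bsub>I\<^esub> f h h''
        \<^bold>+\<^bsub>I\<^esub> (h \<diamondop> (y \<cdot>\<^bsub>I\<^esub> y') \<^bold>+\<^bsub>I\<^esub> h \<diamondop> (y \<leftthreetimes> h)) \<leftthreetimes> (h \<cdot>\<^bsub>H\<^esub> h'')"
    if "y \<in> carrier I" "y' \<in> carrier I" "y'' \<in> carrier I" "h \<in> carrier H" "h'' \<in> carrier H"
    for y y' y'' h h''
    using left[of y y' y'' "\<^bold>0\<^bsub>H\<^esub>" h h'', OF _ _ _ _ _ _ refl refl refl] that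
    by (simp add: \<beta>0)

  show ?thesis
  proof (intro extension_cocycle.intro extension_cocycle_axioms.intro extension_datum_axioms)
    fix h h' h'' assume [simp]: "h \<in> carrier H" "h' \<in> carrier H" "h'' \<in> carrier H"
    show "\<beta> h h' \<^bold>+\<^bsub>I\<^esub> \<beta> (h \<^bold>+\<^bsub>H\<^esub> h') h'' = \<beta> h' h'' \<^bold>+\<^bsub>I\<^esub> \<beta> h (h' \<^bold>+\<^bsub>H\<^esub> h'')"
      using B.m_assoc[of "(\<^bold>0\<^bsub>I\<^esub>, h)" "(\<^bold>0\<^bsub>I\<^esub>, h')" "(\<^bold>0\<^bsub>I\<^esub>, h'')"] by simp
  next
    fix h h' assume [simp]: "h \<in> carrier H" "h' \<in> carrier H"
    show "\<beta> h h' = \<beta> h' h"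
      using B.m_comm[of "(\<^bold>0\<^bsub>I\<^esub>, h)" "(\<^bold>0\<^bsub>I\<^esub>, h')"] by simp
  next
    fix h h' y assume [simp]: "y \<in> carrier I" "h \<in> carrier H" "h' \<in> carrier H"
    \<comment> \<open>When \<open>0\<close> acts, the values of \<open>f\<close> vanish by
      \<open>f0l\<close>, and \<open>\<beta> h h'\<close> cancels because it occurs on both
      sides.\<close>
    show "y \<leftthreetimes> (h \<^bold>+\<^bsub>H\<^esub> h') = y \<leftthreetimes> h \<^bold>+\<^bsub>I\<^esub> y \<leftthreetimes> h'"
      using right[of y "\<^bold>0\<^bsub>H\<^esub>" h h'] by simp
    \<comment> \<open>With \<open>h'' = 0\<close> all terms in \<open>f\<close> and
      \<open>\<leftthreetimes>\<close> vanish, and with zero in the first two slots both left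
      factors are \<open>0\<close>, which acts as the identity.\<close>
    show "(h \<^bold>+\<^bsub>H\<^esub> h') \<diamondop> y = (h \<cdot>\<^bsub>H\<^esub> h') \<diamondop> (h \<diamondop> y)"
      using left[of "\<^bold>0\<^bsub>I\<^esub>" "\<^bold>0\<^bsub>I\<^esub>" y h h' "\<^bold>0\<^bsub>H\<^esub>", OF _ _ _ _ _ _ refl refl refl] by simp
    \<comment> \<open>The products in \<open>I\<close> have right factor \<open>0\<close> and
      vanish; \<open>f h h'\<close> is on both sides and is moved to the front to cancel.\<close>
    show "(h \<diamondop> y) \<leftthreetimes> (h \<cdot>\<^bsub>H\<^esub> h')
        = h \<diamondop> (y \<leftthreetimes> h') \<^bold>+\<^bsub>I\<^esub> (h \<diamondop> (y \<leftthreetimes> h)) \<leftthreetimes> (h \<cdot>\<^bsub>H\<^esub> h')"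
      using left0[of y "\<^bold>0\<^bsub>I\<^esub>" "\<^bold>0\<^bsub>I\<^esub>" h h']
      by (simp add: I.m_lcomm[of _ "f h h'"] I.m_assoc)
  next
    fix h y y' assume [simp]: "h \<in> carrier H" "y \<in> carrier I" "y' \<in> carrier I"
    show "(h \<diamondop> y) \<cdot>\<^bsub>I\<^esub> (h \<diamondop> y') = h \<diamondop> (y \<cdot>\<^bsub>I\<^esub> y')"
      using left0[of y "\<^bold>0\<^bsub>I\<^esub>" y' h "\<^bold>0\<^bsub>H\<^esub>"] by simp
    show "(y \<^bold>+\<^bsub>I\<^esub> y') \<leftthreetimes> h = y \<leftthreetimes> h \<^bold>+\<^bsub>I\<^esub> (y \<cdot>\<^bsub>I\<^esub> y') \<leftthreetimes> h"
      using left0[of y y' "\<^bold>0\<^bsub>I\<^esub>" "\<^bold>0\<^bsub>H\<^esub>" h] by simp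
  next
    fix h assume [simp]: "h \<in> carrier H"
    \<comment> \<open>On pairs \<open>(y, 0)\<close> left multiplication by \<open>(0, h)\<close> is
      the action of \<open>h\<close>, since \<open>f h 0 = 0\<close>.\<close>
    have bij: "bij_betw (\<lambda>Y. (\<^bold>0\<^bsub>I\<^esub>, h) \<cdot>\<^bsub>B\<^esub> Y) (carrier B) (carrier B)"
      by (rule B.dot_bij) simp
    show "bij_betw (\<lambda>y. h \<diamondop> y) (carrier I) (carrier I)"
    proof (rule bij_betwI')
      fix y y' assume [simp]: "y \<in> carrier I" "y' \<in> carrier I"
      have "(\<^bold>0\<^bsub>I\<^esub>, h) \<cdot>\<^bsub>B\<^esub> (y, \<^bold>0\<^bsub>H\<^esub>) = (\<^bold>0\<^bsub>I\<^esub>, h) \<cdot>\<^bsub>B\<^esub> (y', \<^bold>0\<^bsub>H\<^esub>)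
          \<longleftrightarrow> (y, \<^bold>0\<^bsub>H\<^esub>) = (y', \<^bold>0\<^bsub>H\<^esub>)"
        by (rule inj_on_eq_iff[OF bij_betw_imp_inj_on[OF bij]]) simp_all
      then show "h \<diamondop> y = h \<diamondop> y' \<longleftrightarrow> y = y'"
        by simp
    next
      fix x assume [simp]: "x \<in> carrier I"
      have "(x, \<^bold>0\<^bsub>H\<^esub>) \<in> (\<lambda>Y. (\<^bold>0\<^bsub>I\<^esub>, h) \<cdot>\<^bsub>B\<^esub> Y) ` carrier B"
        unfolding bij_betw_imp_surj_on[OF bij] by simp
      then obtain Y where "Y \<in> carrier B" and Y: "(x, \<^bold>0\<^bsub>H\<^esub>) = (\<^bold>0\<^bsub>I\<^esub>, h) \<cdot>\<^bsub>B\<^esub> Y"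
        by (elim imageE)
      then obtain y h' where eq: "Y = (y, h')" and [simp]: "y \<in> carrier I" "h' \<in> carrier H"
        by auto
      \<comment> \<open>For surjectivity the preimage must itself have second component
        \<open>0\<close>; injectivity of multiplication by \<open>h\<close> in \<open>H\<close>
        yields this.\<close>
      have "\<^bold>0\<^bsub>H\<^esub> = h \<cdot>\<^bsub>H\<^esub> h'" using Y by (simp add: eq)
      from this[symmetric] have "h \<cdot>\<^bsub>H\<^esub> h' = h \<cdot>\<^bsub>H\<^esub> \<^bold>0\<^bsub>H\<^esub>" by simp
      then have "h' = \<^bold>0\<^bsub>H\<^esub>"
        by (rule inj_onD[OF bij_betw_imp_inj_on[OF H.dot_bij[OF \<open>h \<in> carrier H\<close>]]]) simp_all
      then show "\<exists>y\<in>carrier I. x = h \<diamondop> y"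
        using Y by (intro bexI[of _ y]) (simp_all add: eq)
    qed simp
  qed (use \<beta>0 f_right f_left in auto)
qed

end

section \<open>Equivalence of the extension property with the conditions\<close>

theorem corollary4p7:
  fixes I :: "('i, 'm) cycle_struct_scheme" and H :: "('h, 'n) cycle_struct_scheme"
    and dia :: "'h \<Rightarrow> 'i \<Rightarrow> 'i" (infixr \<open>\<diamondop>\<close> 75)
    and tri :: "'i \<Rightarrow> 'h \<Rightarrow> 'i" (infixl \<open>\<leftthreetimes>\<close> 75)
    and \<beta> f :: "'h \<Rightarrow> 'h \<Rightarrow> 'i"
  assumes "linear_cycle_set I" and "linear_cycle_set H"
    and "(\<diamondop>) \<in> carrier H \<rightarrow> carrier I \<rightarrow> carrier I"
    and "(\<leftthreetimes>) \<in> carrier I \<rightarrow> carrier H \<rightarrow> carrier I"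
    and "\<beta> \<in> carrier H \<rightarrow> carrier H \<rightarrow> carrier I"
    and "f \<in> carrier H \<rightarrow> carrier H \<rightarrow> carrier I"
    and "\<forall>h\<in>carrier H. \<forall>y\<in>carrier I. \<forall>y'\<in>carrier I.
      h \<diamondop> (y \<^bold>+\<^bsub>I\<^esub> y') = (h \<diamondop> y) \<^bold>+\<^bsub>I\<^esub> (h \<diamondop> y')"
    and "\<forall>y\<in>carrier I. \<^bold>0\<^bsub>H\<^esub> \<diamondop> y = y"
    and "\<forall>h\<in>carrier H. \<^bold>0\<^bsub>I\<^esub> \<leftthreetimes> h = \<^bold>0\<^bsub>I\<^esub>"
    and "\<forall>y\<in>carrier I. y \<leftthreetimes> \<^bold>0\<^bsub>H\<^esub> = \<^bold>0\<^bsub>I\<^esub>"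
    and "\<forall>h\<in>carrier H. \<forall>y\<in>carrier I. \<forall>h'\<in>carrier H. h \<diamondop> (y \<leftthreetimes> h') \<in> lcs_center I"
    and "\<forall>h\<in>carrier H. \<forall>h'\<in>carrier H. \<forall>h''\<in>carrier H. h \<diamondop> \<beta> h' h'' \<in> lcs_center I"
    and "\<forall>h\<in>carrier H. \<forall>h'\<in>carrier H. \<forall>h''\<in>carrier H. h \<diamondop> f h' h'' \<in> lcs_center I"
  shows "linear_cycle_set (ext_prod I H (\<diamondop>) (\<leftthreetimes>) \<beta> f) \<and>
      lcs_extension I (ext_prod I H (\<diamondop>) (\<leftthreetimes>) \<beta> f) H (\<lambda>y. (y, \<^bold>0\<^bsub>H\<^esub>)) (\<lambda>(y, h). h)
    \<longleftrightarrow>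
      (\<forall>h\<in>carrier H. bij_betw (\<lambda>y. h \<diamondop> y) (carrier I) (carrier I)) \<and>
      (\<forall>h\<in>carrier H. \<forall>h'\<in>carrier H. \<forall>h''\<in>carrier H. \<forall>y\<in>carrier I. \<forall>y'\<in>carrier I.
        \<beta> h h' \<^bold>+\<^bsub>I\<^esub> \<beta> (h \<^bold>+\<^bsub>H\<^esub> h') h'' = \<beta> h' h'' \<^bold>+\<^bsub>I\<^esub> \<beta> h (h' \<^bold>+\<^bsub>H\<^esub> h'') \<and>
        \<beta> h \<^bold>0\<^bsub>H\<^esub> = \<^bold>0\<^bsub>I\<^esub> \<and> \<beta> \<^bold>0\<^bsub>H\<^esub> h = \<^bold>0\<^bsub>I\<^esub> \<and> \<beta> h h' = \<beta> h' h \<and>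
        (h \<diamondop> \<beta> h' h'') \<^bold>+\<^bsub>I\<^esub> f h (h' \<^bold>+\<^bsub>H\<^esub> h'')
          = f h h' \<^bold>+\<^bsub>I\<^esub> f h h'' \<^bold>+\<^bsub>I\<^esub> \<beta> (h \<cdot>\<^bsub>H\<^esub> h') (h \<cdot>\<^bsub>H\<^esub> h'') \<and>
        y \<leftthreetimes> (h' \<^bold>+\<^bsub>H\<^esub> h'') = (y \<leftthreetimes> h') \<^bold>+\<^bsub>I\<^esub> (y \<leftthreetimes> h'') \<and>
        (h \<diamondop> y) \<cdot>\<^bsub>I\<^esub> (h \<diamondop> y') = h \<diamondop> (y \<cdot>\<^bsub>I\<^esub> y') \<and>
        (h \<^bold>+\<^bsub>H\<^esub> h') \<diamondop> y = (h \<cdot>\<^bsub>H\<^esub> h') \<diamondop> (h \<diamondop> y) \<and>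
        (y \<^bold>+\<^bsub>I\<^esub> y') \<leftthreetimes> h = (y \<leftthreetimes> h) \<^bold>+\<^bsub>I\<^esub> ((y \<cdot>\<^bsub>I\<^esub> y') \<leftthreetimes> h) \<and>
        (h \<diamondop> y) \<leftthreetimes> (h \<cdot>\<^bsub>H\<^esub> h')
          = (h \<diamondop> (y \<leftthreetimes> h')) \<^bold>+\<^bsub>I\<^esub> ((h \<diamondop> (y \<leftthreetimes> h)) \<leftthreetimes> (h \<cdot>\<^bsub>H\<^esub> h')) \<and>
        f (h \<^bold>+\<^bsub>H\<^esub> h') h'' \<^bold>+\<^bsub>I\<^esub> (((h \<^bold>+\<^bsub>H\<^esub> h') \<diamondop> \<beta> h h') \<leftthreetimes> ((h \<^bold>+\<^bsub>H\<^esub> h') \<cdot>\<^bsub>H\<^esub> h''))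
          = ((h \<cdot>\<^bsub>H\<^esub> h') \<diamondop> f h h'') \<^bold>+\<^bsub>I\<^esub> f (h \<cdot>\<^bsub>H\<^esub> h') (h \<cdot>\<^bsub>H\<^esub> h'')
            \<^bold>+\<^bsub>I\<^esub> (((h \<cdot>\<^bsub>H\<^esub> h') \<diamondop> f h h') \<leftthreetimes> ((h \<cdot>\<^bsub>H\<^esub> h') \<cdot>\<^bsub>H\<^esub> (h \<cdot>\<^bsub>H\<^esub> h''))))"
proof -
  interpret extension_datum I H dia tri \<beta> f
  proof (intro extension_datum.intro extension_datum_axioms.intro)
    have zero: "\<^bold>0\<^bsub>H\<^esub> \<in> carrier H"
      using assms(2) by (simp add: linear_cycle_set_def comm_group_def comm_monoid.axioms(1) monoid.one_closed)
    fix h assume h: "h \<in> carrier H"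
    {
      fix y assume y: "y \<in> carrier I"
      \<comment> \<open>Membership in \<open>carrier I\<close> allows
        \<open>0 \<diamondop> (y \<leftthreetimes> h)\<close> to be replaced by
        \<open>y \<leftthreetimes> h\<close> in the centrality hypothesis; the same is done for
        \<open>\<beta>\<close> and \<open>f\<close> below.\<close>
      have "y \<leftthreetimes> h \<in> carrier I" using assms(4) h y by auto
      then show "y \<leftthreetimes> h \<in> lcs_center I"
        using assms(11)[rule_format, OF zero y h] assms(8) by simp
    }
    fix h' assume h': "h' \<in> carrier H"
    have "\<beta> h h' \<in> carrier I" "f h h' \<in> carrier I"
      using assms(5,6) h h' by auto
    then show "\<beta> h h' \<in> lcs_center I" "f h h' \<in> lcs_center I"
      using assms(12,13)[rule_format, OF zero h h'] assms(8) by simp_all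
  qed (use assms in auto)
  show ?thesis (is "?ext \<longleftrightarrow> ?cond")
  proof
    assume ?ext
    then interpret extension_cocycle I H dia tri \<beta> f
      by (intro extension_cocycle_of_linear_cycle_set) auto
    show ?cond
      by (intro conjI ballI)
        (rule dia_bij \<beta>_cocycle \<beta>_zero_right \<beta>_zero_left \<beta>_commute f_add_right tri_add_right
          dia_dot add_dia tri_add_left dia_tri f_add_left; assumption)+
  next
    assume cond: ?cond
    \<comment> \<open>All five variables are quantified jointly, so a condition mentioning fewer of
      them is extracted by filling the other slots with \<open>0\<close> or a repeated
      element.\<close>
    note cocycle = cond[THEN conjunct2, rule_format]
    interpret extension_cocycle I H dia tri \<beta> f
    proof (intro extension_cocycle.intro extension_cocycle_axioms.intro extension_datum_axioms)
      fix h assume h: "h \<in> carrier H"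
      show "bij_betw (\<lambda>y. h \<diamondop> y) (carrier I) (carrier I)"
        using cond h by blast
      show "\<beta> h \<^bold>0\<^bsub>H\<^esub> = \<^bold>0\<^bsub>I\<^esub>" "\<beta> \<^bold>0\<^bsub>H\<^esub> h = \<^bold>0\<^bsub>I\<^esub>"
        using cocycle[OF h h h I.one_closed I.one_closed] by blast+
      fix h' assume h': "h' \<in> carrier H"
      show "\<beta> h h' = \<beta> h' h"
        using cocycle[OF h h' h I.one_closed I.one_closed] by blast
      {
        fix h'' assume h'': "h'' \<in> carrier H"
        note cocycle' = cocycle[OF h h' h'' I.one_closed I.one_closed]
        show "\<beta> h h' \<^bold>+\<^bsub>I\<^esub> \<beta> (h \<^bold>+\<^bsub>H\<^esub> h') h'' = \<beta> h' h'' \<^bold>+\<^bsub>I\<^esub> \<beta> h (h' \<^bold>+\<^bsub>H\<^esub> h'')"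
          using cocycle' by blast
        show "(h \<diamondop> \<beta> h' h'') \<^bold>+\<^bsub>I\<^esub> f h (h' \<^bold>+\<^bsub>H\<^esub> h'')
            = f h h' \<^bold>+\<^bsub>I\<^esub> f h h'' \<^bold>+\<^bsub>I\<^esub> \<beta> (h \<cdot>\<^bsub>H\<^esub> h') (h \<cdot>\<^bsub>H\<^esub> h'')"
          using cocycle' by blast
        show "f (h \<^bold>+\<^bsub>H\<^esub> h') h'' \<^bold>+\<^bsub>I\<^esub> (((h \<^bold>+\<^bsub>H\<^esub> h') \<diamondop> \<beta> h h') \<leftthreetimes> ((h \<^bold>+\<^bsub>H\<^esub> h') \<cdot>\<^bsub>H\<^esub> h''))
            = ((h \<cdot>\<^bsub>H\<^esub> h') \<diamondop> f h h'') \<^bold>+\<^bsub>I\<^esub> f (h \<cdot>\<^bsub>H\<^esub> h') (h \<cdot>\<^bsub>H\<^esub> h'')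
              \<^bold>+\<^bsub>I\<^esub> (((h \<cdot>\<^bsub>H\<^esub> h') \<diamondop> f h h') \<leftthreetimes> ((h \<cdot>\<^bsub>H\<^esub> h') \<cdot>\<^bsub>H\<^esub> (h \<cdot>\<^bsub>H\<^esub> h'')))"
          using cocycle' by blast
      }
      fix y assume y: "y \<in> carrier I"
      \<comment> \<open>Two instances, because additivity of \<open>\<leftthreetimes>\<close> on the
        right is stated for the second and third elements of \<open>H\<close>, the other two
        conditions for the first and second.\<close>
      note cocycle' = cocycle[OF h h h' y y] cocycle[OF h h' h' y y]
      show "y \<leftthreetimes> (h \<^bold>+\<^bsub>H\<^esub> h') = (y \<leftthreetimes> h) \<^bold>+\<^bsub>I\<^esub> (y \<leftthreetimes> h')"
        using cocycle' by blast
      show "(h \<^bold>+\<^bsub>H\<^esub> h') \<diamondop> y = (h \<cdot>\<^bsub>H\<^esub> h') \<diamondop> (h \<diamondop> y)"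
        using cocycle' by blast
      show "(h \<diamondop> y) \<leftthreetimes> (h \<cdot>\<^bsub>H\<^esub> h')
          = (h \<diamondop> (y \<leftthreetimes> h')) \<^bold>+\<^bsub>I\<^esub> ((h \<diamondop> (y \<leftthreetimes> h)) \<leftthreetimes> (h \<cdot>\<^bsub>H\<^esub> h'))"
        using cocycle' by blast
    next
      fix h y y' assume "h \<in> carrier H" "y \<in> carrier I" "y' \<in> carrier I"
      note cocycle' = cocycle[OF this(1) this(1) this]
      show "(h \<diamondop> y) \<cdot>\<^bsub>I\<^esub> (h \<diamondop> y') = h \<diamondop> (y \<cdot>\<^bsub>I\<^esub> y')"
        using cocycle' by blast
      show "(y \<^bold>+\<^bsub>I\<^esub> y') \<leftthreetimes> h = (y \<leftthreetimes> h) \<^bold>+\<^bsub>I\<^esub> ((y \<cdot>\<^bsub>I\<^esub> y') \<leftthreetimes> h)"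
        using cocycle' by blast
    qed
    show ?ext
      using ext_linear_cycle_set ext_lcs_extension by blast
  qed
qed

end
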